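(* Let $\lambda>0$, $\gamma\ge0$, and let $\Omega\subset\mathbb{R}^2$ be a bounded simply connected domain of class $C^2$ with $\overline{B_\lambda}\subset\Omega$. Suppose that for some constant $Q>0$ there is a solution $\psi\in C^2(\overline{\Omega\setminus B_\lambda})$ of $$\begin{cases}\Delta\psi=\gamma&\text{in }\Omega\setminus\overline{B_\lambda},\\ \psi=0&\text{on }\partial\Omega,\\ \psi=1&\text{on }\partial B_\lambda,\\ |\nabla\psi|^2=Q&\text{on }\partial\Omega,\end{cases}$$ with $\psi>0$ in $\Omega\setminus\overline{B_\lambda}$. Then $\Omega\setminus\overline{B_\lambda}$ must be an annulus, and every such positive solution is radially symmetric and decreasing in $|x|$.
   Context: $B_\lambda\subset\mathbb{R}^2$ is the open disk of radius $\lambda$ centered at the origin. An annulus is the region between two concentric circles. *)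

theory Defs
  imports "HOL-Analysis.Analysis"
begin

section \<open>Differential operators\<close>

definition partial_deriv :: "'n \<Rightarrow> (real^'n \<Rightarrow> real) \<Rightarrow> real^'n \<Rightarrow> real" where
  "partial_deriv i f x = frechet_derivative f (at x) (axis i 1)"

definition grad :: "(real^'n \<Rightarrow> real) \<Rightarrow> real^'n \<Rightarrow> real^'n" where
  "grad f x = (\<chi> i. partial_deriv i f x)"

definition laplacian :: "(real^'n \<Rightarrow> real) \<Rightarrow> real^'n \<Rightarrow> real" where
  "laplacian f x = (\<Sum>i\<in>UNIV. partial_deriv i (partial_deriv i f) x)"

section \<open>Functions of class C2\<close>

text \<open>The set \<open>U\<close> is always open here, so the derivatives at points of \<open>U\<close> depend only on
  the values of \<open>f\<close> in \<open>U\<close>.\<close>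

definition C2_on :: "(real^'n) set \<Rightarrow> (real^'n \<Rightarrow> real) \<Rightarrow> bool" where
  "C2_on U f \<longleftrightarrow>
     f differentiable_on U \<and>
     (\<forall>i. partial_deriv i f differentiable_on U) \<and>
     (\<forall>i j. continuous_on U (partial_deriv j (partial_deriv i f)))"

definition extends_continuously :: "('a::topological_space) set \<Rightarrow> ('a \<Rightarrow> 'b::topological_space) \<Rightarrow> bool" where
  "extends_continuously U f \<longleftrightarrow> (\<exists>g. continuous_on (closure U) g \<and> (\<forall>x\<in>U. g x = f x))"

text \<open>Class C2 up to the boundary of the open set \<open>U\<close>: all derivatives of order at most two exist
  in \<open>U\<close> and extend continuously to the closure of \<open>U\<close>.  The values of \<open>f\<close> itself on the
  boundary are required to be those of its own extension.\<close>

definition C2_closure :: "(real^'n) set \<Rightarrow> (real^'n \<Rightarrow> real) \<Rightarrow> bool" where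
  "C2_closure U f \<longleftrightarrow>
     C2_on U f \<and> continuous_on (closure U) f \<and>
     (\<forall>i. extends_continuously U (partial_deriv i f)) \<and>
     (\<forall>i j. extends_continuously U (partial_deriv j (partial_deriv i f)))"

text \<open>The gradient at a boundary point of \<open>U\<close> is the value of the continuous extension of the
  gradient from \<open>U\<close>.\<close>

definition grad_closure :: "(real^'n) set \<Rightarrow> (real^'n \<Rightarrow> real) \<Rightarrow> real^'n \<Rightarrow> real^'n" where
  "grad_closure U f x = Lim (at x within U) (grad f)"

section \<open>Planar domains\<close>

definition C2_real :: "(real \<Rightarrow> real) \<Rightarrow> bool" where
  "C2_real \<phi> \<longleftrightarrow> (\<exists>\<phi>' \<phi>''.
     (\<forall>t. (\<phi> has_real_derivative \<phi>' t) (at t)) \<and>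
     (\<forall>t. (\<phi>' has_real_derivative \<phi>'' t) (at t)) \<and>
     continuous_on UNIV \<phi>'')"

text \<open>Near each boundary point, in suitable orthonormal coordinates \<open>(x \<bullet> e, x \<bullet> n)\<close>, the set
  is the region strictly above the graph of a C2 function.\<close>

definition C2_boundary :: "(real^2) set \<Rightarrow> bool" where
  "C2_boundary \<Omega> \<longleftrightarrow>
     (\<forall>p\<in>frontier \<Omega>. \<exists>r>0. \<exists>e n \<phi>.
        norm e = 1 \<and> norm n = 1 \<and> e \<bullet> n = 0 \<and> C2_real \<phi> \<and>
        \<Omega> \<inter> ball p r = {x \<in> ball p r. \<phi> (x \<bullet> e) < x \<bullet> n})"

definition is_annulus :: "(real^2) set \<Rightarrow> bool" where
  "is_annulus A \<longleftrightarrow> (\<exists>c r R. 0 < r \<and> r < R \<and> A = {x. r < dist c x \<and> dist c x < R})"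

definition radially_decreasing_on :: "(real^2) set \<Rightarrow> (real^2 \<Rightarrow> real) \<Rightarrow> bool" where
  "radially_decreasing_on S f \<longleftrightarrow>
     (\<exists>g. (\<forall>x\<in>S. f x = g (norm x)) \<and> strict_antimono_on (norm ` S) g)"

section \<open>The overdetermined problem\<close>

definition positive_solution ::
  "real \<Rightarrow> real \<Rightarrow> (real^2) set \<Rightarrow> real \<Rightarrow> (real^2 \<Rightarrow> real) \<Rightarrow> bool" where
  "positive_solution lam \<gamma> \<Omega> Q \<psi> \<longleftrightarrow>
     C2_closure (\<Omega> - cball 0 lam) \<psi> \<and>
     (\<forall>x\<in>\<Omega> - cball 0 lam. laplacian \<psi> x = \<gamma>) \<and>
     (\<forall>x\<in>frontier \<Omega>. \<psi> x = 0) \<and>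
     (\<forall>x\<in>frontier (ball 0 lam). \<psi> x = 1) \<and>
     (\<forall>x\<in>frontier \<Omega>. (norm (grad_closure (\<Omega> - cball 0 lam) \<psi> x))\<^sup>2 = Q) \<and>
     (\<forall>x\<in>\<Omega> - cball 0 lam. \<psi> x > 0)"

end

theory Submission
  imports Defs
begin

text \<open>Write \<open>l\<close> for the inner radius. The functions
  \<open>V\<^sub>a(r) = 1 + a ln (r/l) + \<gamma> (r\<^sup>2 - l\<^sup>2)/4\<close> of \<open>r = |x|\<close> have laplacian \<open>\<gamma>\<close> and value \<open>1\<close> on the
  inner circle; exactly one \<open>a = A(R)\<close> makes \<open>V\<^sub>a\<close> vanish at \<open>R\<close>, and its slope at \<open>R\<close> is strictly
  increasing in \<open>R\<close>. Let \<open>R1 \<le> R2\<close> be the least and the greatest norm on the outer boundary.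
  On \<open>l < |x| < R1\<close> the maximum principle gives \<open>\<psi> \<ge> V\<^sub>a\<close> with \<open>a = A(R1)\<close>, so the slope at \<open>R1\<close> is
  at least \<open>-\<surd>Q\<close>. For the other side take \<open>a\<close> to be the maximum of \<open>A(|x|)\<close> over the outer
  boundary, attained at \<open>p\<close>: then \<open>V\<^sub>a \<ge> 0\<close> there, so \<open>\<psi> \<le> V\<^sub>a\<close>. By connectedness every norm in
  \<open>(l, R2)\<close> occurs in the domain, so positivity of \<open>\<psi>\<close> makes \<open>V\<^sub>a\<close> positive on \<open>(l, R2)\<close>; hence
  \<open>|p| = R2\<close>, and comparing normal derivatives at \<open>p\<close> shows that the slope at \<open>R2\<close> is at most \<open>-\<surd>Q\<close>.
  Monotonicity of the slope forces \<open>R1 = R2\<close>, and then \<open>\<psi>\<close> is squeezed between equal profiles.\<close>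

section \<open>Derivatives along lines and at boundary points\<close>

lemma grad_has_derivative:
  fixes f :: "real^'n \<Rightarrow> real"
  assumes "f differentiable (at x)"
  shows "(f has_derivative (\<lambda>v. grad f x \<bullet> v)) (at x)"
proof -
  let ?D = "frechet_derivative f (at x)"
  have D: "(f has_derivative ?D) (at x)"
    using assms frechet_derivative_works by blast
  then have "linear ?D"
    by (rule has_derivative_linear)
  have "?D v = grad f x \<bullet> v" for v
  proof -
    have "v = (\<Sum>i\<in>UNIV. (v $ i) *\<^sub>R axis i 1)"
      by (metis basis_expansion scalar_mult_eq_scaleR)
    then have "?D v = (\<Sum>i\<in>UNIV. ?D ((v $ i) *\<^sub>R axis i 1))"
      using linear_sum[OF \<open>linear ?D\<close>] by metis
    also have "\<dots> = grad f x \<bullet> v"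
      by (simp add: linear_scale[OF \<open>linear ?D\<close>] grad_def partial_deriv_def inner_vec_def mult.commute)
    finally show ?thesis .
  qed
  then have "?D = (\<lambda>v. grad f x \<bullet> v)" by blast
  with D show ?thesis by simp
qed

lemma has_real_derivative_along_line:
  fixes f :: "real^'n \<Rightarrow> real"
  assumes "f differentiable (at (x + t *\<^sub>R v))"
  shows "((\<lambda>s. f (x + s *\<^sub>R v)) has_real_derivative grad f (x + t *\<^sub>R v) \<bullet> v) (at t)"
proof -
  have "((\<lambda>s. x + s *\<^sub>R v) has_derivative (\<lambda>s. s *\<^sub>R v)) (at t)"
    by (auto intro!: derivative_eq_intros)
  then have "((\<lambda>s. f (x + s *\<^sub>R v)) has_derivative (\<lambda>s. grad f (x + t *\<^sub>R v) \<bullet> (s *\<^sub>R v))) (at t)"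
    by (rule has_derivative_compose) (rule grad_has_derivative[OF assms])
  then show ?thesis
    by (simp add: has_field_derivative_def mult.commute[of _ "grad _ _ \<bullet> _"])
qed

lemma partial_deriv_along_axis:
  fixes f :: "real^'n \<Rightarrow> real"
  assumes "f differentiable (at x)"
  shows "((\<lambda>t. f (x + t *\<^sub>R axis i 1)) has_real_derivative partial_deriv i f x) (at 0)"
  using has_real_derivative_along_line[of f x 0 "axis i 1"] assms
  by (simp add: grad_def inner_axis)

text \<open>At a boundary point only the limit \<open>G\<close> of the gradient from inside is
  available. L'Hopital's rule in \<open>t\<close> replaces differentiability at \<open>p\<close>:
  near 0 the numerator has derivative \<open>grad f (p + t *\<^sub>R v) \<bullet> v\<close>, which
  tends to \<open>G \<bullet> v\<close>, and the denominator has derivative 1.\<close>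

lemma directional_quotient_tendsto:
  fixes f :: "real^'n \<Rightarrow> real"
  assumes "open U" and "continuous_on (closure U) f" and "f differentiable_on U"
    and G: "(grad f \<longlongrightarrow> G) (at p within U)"
    and p: "p \<in> closure U" and "p \<notin> U"
    and ev: "eventually (\<lambda>t. p + t *\<^sub>R v \<in> U) (at_right 0)"
  shows "((\<lambda>t. (f (p + t *\<^sub>R v) - f p) / t) \<longlongrightarrow> G \<bullet> v) (at_right 0)"
proof -
  have line: "((\<lambda>t. p + t *\<^sub>R v) \<longlongrightarrow> p) (at_right 0)"
    by (auto intro!: tendsto_eq_intros)
  have "filterlim (\<lambda>t. p + t *\<^sub>R v) (at p within U) (at_right 0)"
    unfolding filterlim_at using line ev \<open>p \<notin> U\<close> by (auto elim!: eventually_mono)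
  then have lim: "((\<lambda>t. grad f (p + t *\<^sub>R v) \<bullet> v / 1) \<longlongrightarrow> G \<bullet> v) (at_right 0)"
    using filterlim_compose[OF G] by (auto intro!: tendsto_eq_intros)
  have "filterlim (\<lambda>t. p + t *\<^sub>R v) (at p within closure U) (at_right 0)"
    unfolding filterlim_at using line ev \<open>p \<notin> U\<close> closure_subset[of U]
    by (auto elim!: eventually_mono)
  moreover have "(f \<longlongrightarrow> f p) (at p within closure U)"
    using assms(2) p by (simp add: continuous_on_def)
  ultimately have "((\<lambda>t. f (p + t *\<^sub>R v)) \<longlongrightarrow> f p) (at_right 0)"
    using filterlim_compose by blast
  then have f0: "((\<lambda>t. f (p + t *\<^sub>R v) - f p) \<longlongrightarrow> 0) (at_right 0)"
    using LIM_zero by blast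
  have der: "eventually (\<lambda>t. ((\<lambda>t. f (p + t *\<^sub>R v) - f p) has_real_derivative
      grad f (p + t *\<^sub>R v) \<bullet> v) (at t)) (at_right 0)"
    using ev
  proof eventually_elim
    case (elim t)
    then have "f differentiable (at (p + t *\<^sub>R v))"
      using assms(1,3) by (metis differentiable_on_def at_within_open)
    then show ?case
      using has_real_derivative_along_line by (auto intro!: derivative_eq_intros)
  qed
  show ?thesis
    by (rule lhopital_right_0[OF f0 _ _ _ der _ lim])
      (auto intro!: tendsto_eq_intros eventually_mono[OF eventually_at_right_less])
qed

section \<open>The weak maximum principle\<close>

text \<open>If \<open>c\<close> were positive, \<open>h'\<close>, which vanishes at the maximum
  \<open>a\<close>, would be positive just to the right of \<open>a\<close>, and the mean value
  theorem would give a larger value of \<open>h\<close> there. The second derivative is required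
  only at \<open>a\<close> itself.\<close>

lemma second_derivative_nonpos_at_max:
  fixes h :: "real \<Rightarrow> real"
  assumes "eventually (\<lambda>t. (h has_real_derivative h' t) (at t)) (nhds a)"
    and c: "(h' has_real_derivative c) (at a)"
    and "eventually (\<lambda>t. h t \<le> h a) (nhds a)"
  shows "c \<le> 0"
proof (rule ccontr)
  assume "\<not> c \<le> 0"
  then have "c > 0" by simp
  have "eventually (\<lambda>t. (h has_real_derivative h' t) (at t) \<and> h t \<le> h a) (nhds a)"
    using assms(1,3) by eventually_elim auto
  then obtain d where d: "d > 0"
      "\<And>t. dist t a < d \<Longrightarrow> (h has_real_derivative h' t) (at t) \<and> h t \<le> h a"
    unfolding eventually_nhds_metric by blast
  have "h' a = 0"
    using DERIV_local_max[of h "h' a" a d] d by (auto simp: dist_real_def abs_minus_commute)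
  obtain e where e: "e > 0" "\<And>s. 0 < s \<Longrightarrow> s < e \<Longrightarrow> h' a < h' (a + s)"
    using DERIV_pos_inc_right[OF c \<open>c > 0\<close>] by blast
  define t where "t = a + min d e / 2"
  have t: "a < t" "t < a + d" "t < a + e"
    using d(1) e(1) by (auto simp: t_def min_def field_simps)
  have "\<exists>z. a < z \<and> z < t \<and> h t - h a = (t - a) * h' z"
    using t by (intro MVT2) (auto intro!: d(2)[THEN conjunct1] simp: dist_real_def)
  then obtain z where z: "a < z" "z < t" "h t - h a = (t - a) * h' z" by blast
  have "h' z > 0"
    using e(2)[of "z - a"] z t \<open>h' a = 0\<close> by auto
  then have "h t > h a"
    using z t by (smt (verit) mult_pos_pos)
  moreover have "h t \<le> h a"
    using d(2)[of t] t by (auto simp: dist_real_def)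
  ultimately show False by simp
qed

text \<open>Adding a small multiple of the squared norm makes \<open>w\<close> strictly subharmonic,
  which excludes an interior maximum. The pure second derivatives enter as explicit one-variable
  derivatives \<open>d\<close> and \<open>d2\<close>, so that closed formulas for the radial profile
  can be supplied directly.\<close>

lemma weak_maximum_principle:
  fixes w :: "real^'n \<Rightarrow> real" and d d2 :: "'n \<Rightarrow> real^'n \<Rightarrow> real"
  assumes "open U" and "bounded U" and cont: "continuous_on (closure U) w"
    and d: "\<And>x i. x \<in> U \<Longrightarrow> ((\<lambda>t. w (x + t *\<^sub>R axis i 1)) has_real_derivative d i x) (at 0)"
    and d2: "\<And>x i. x \<in> U \<Longrightarrow> ((\<lambda>t. d i (x + t *\<^sub>R axis i 1)) has_real_derivative d2 i x) (at 0)"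
    and subharmonic: "\<And>x. x \<in> U \<Longrightarrow> (\<Sum>i\<in>UNIV. d2 i x) \<ge> 0"
    and bdry: "\<And>x. x \<in> frontier U \<Longrightarrow> w x \<le> 0"
    and "x \<in> closure U"
  shows "w x \<le> 0"
proof (rule ccontr)
  assume "\<not> w x \<le> 0"
  then have "w x > 0" by simp
  have comp: "compact (closure U)"
    using \<open>bounded U\<close> by (simp add: compact_closure)
  obtain B where B: "B > 0" "\<And>y. y \<in> closure U \<Longrightarrow> norm y \<le> B"
    using compact_imp_bounded[OF comp] bounded_pos by metis
  \<comment> \<open>With this \<open>e\<close> the added term is at most \<open>w x / 2\<close> on
    the closure, so \<open>z\<close> stays below \<open>w x\<close> on the frontier and its maximum
    lies inside \<open>U\<close>.\<close>
  define e where "e = w x / (2 * B\<^sup>2)"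
  have "e > 0" using \<open>w x > 0\<close> B by (simp add: e_def)
  define z where "z y = w y + e * (y \<bullet> y)" for y
  have "continuous_on (closure U) z"
    unfolding z_def by (intro continuous_intros cont)
  then obtain m where m: "m \<in> closure U" "\<And>y. y \<in> closure U \<Longrightarrow> z y \<le> z m"
    using continuous_attains_sup[OF comp, of z] \<open>x \<in> closure U\<close> by (metis empty_iff)
  have "m \<in> U"
  proof (rule ccontr)
    assume "m \<notin> U"
    then have "m \<in> frontier U"
      using m(1) \<open>open U\<close> by (simp add: frontier_def interior_open)
    then have "z m \<le> e * (m \<bullet> m)" using bdry by (simp add: z_def)
    also have "\<dots> \<le> e * B\<^sup>2"
      using B m(1) \<open>e > 0\<close> by (simp add: dot_square_norm power_mono)
    also have "\<dots> < w x" using \<open>w x > 0\<close> B by (simp add: e_def)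
    also have "\<dots> \<le> z x" using \<open>e > 0\<close> by (simp add: z_def)
    also have "\<dots> \<le> z m" using m(2) \<open>x \<in> closure U\<close> .
    finally show False by simp
  qed
  have "d2 i m + 2 * e \<le> 0" for i
  proof -
    let ?l = "\<lambda>t. m + t *\<^sub>R axis i 1 :: real^'n"
    have "((\<lambda>t. ?l t) \<longlongrightarrow> m) (nhds 0)"
      by (auto intro!: tendsto_eq_intros filterlim_ident)
    then have inU: "eventually (\<lambda>t. ?l t \<in> U) (nhds 0)"
      using \<open>open U\<close> \<open>m \<in> U\<close> topological_tendstoD by blast
    have "eventually (\<lambda>t. ((\<lambda>t. z (?l t)) has_real_derivative
        d i (?l t) + e * (2 * (?l t $ i))) (at t)) (nhds 0)"
      using inU
    proof eventually_elim
      case (elim t)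
      \<comment> \<open>The hypothesis on \<open>d\<close> gives derivatives at parameter 0 only;
        taking \<open>?l t\<close> as the base point and shifting the parameter gives them at
        \<open>t\<close>.\<close>
      have "((\<lambda>s. w (?l s)) has_real_derivative d i (?l t)) (at t)"
        using d[OF elim, of i] DERIV_shift[of "\<lambda>s. w (?l s)" "d i (?l t)" 0 t]
        by (simp add: algebra_simps)
      moreover have "((\<lambda>s. ?l s \<bullet> ?l s) has_real_derivative 2 * (?l t $ i)) (at t)"
        by (simp add: inner_add_left inner_add_right inner_axis inner_axis_axis inner_commute)
           (auto intro!: derivative_eq_intros simp: inner_axis inner_commute)
      ultimately show ?case
        unfolding z_def by (auto intro!: derivative_eq_intros)
    qed
    moreover have "((\<lambda>t. d i (?l t) + e * (2 * (?l t $ i))) has_real_derivative d2 i m + 2 * e) (at 0)"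
      using d2[OF \<open>m \<in> U\<close>, of i] by (auto intro!: derivative_eq_intros)
    moreover have "eventually (\<lambda>t. z (?l t) \<le> z (?l 0)) (nhds 0)"
      using inU by eventually_elim (use m(2) closure_subset in auto)
    ultimately show ?thesis
      by (rule second_derivative_nonpos_at_max)
  qed
  then have "(\<Sum>i\<in>UNIV. d2 i m + 2 * e) \<le> 0"
    by (intro sum_nonpos) auto
  moreover have "(\<Sum>i\<in>UNIV. d2 i m + 2 * e) \<ge> 0 + real CARD('n) * (2 * e)"
    using subharmonic[OF \<open>m \<in> U\<close>] by (simp add: sum.distrib)
  moreover have "real CARD('n) * (2 * e) > 0"
    using \<open>e > 0\<close> by simp
  ultimately show False by linarith
qed

section \<open>Radial profiles and comparison with them\<close>

definition radial_profile :: "real \<Rightarrow> real \<Rightarrow> real \<Rightarrow> real \<Rightarrow> real" where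
  "radial_profile l \<gamma> a r = 1 + a * ln (r / l) + \<gamma> * (r\<^sup>2 - l\<^sup>2) / 4"

lemma radial_profile_inner [simp]: "l > 0 \<Longrightarrow> radial_profile l \<gamma> a l = 1"
  by (simp add: radial_profile_def)

lemma radial_profile_has_real_derivative:
  assumes "l > 0" "r > 0"
  shows "(radial_profile l \<gamma> a has_real_derivative a / r + \<gamma> * r / 2) (at r)"
  unfolding radial_profile_def[abs_def] using assms
  by (auto intro!: derivative_eq_intros simp: field_simps)

text \<open>The derivative is written through \<open>x \<bullet> x\<close> rather than the norm, so
  that along an axis it is a rational function of \<open>t\<close> and is easily differentiated a
  second time.\<close>

lemma radial_profile_along_line:
  fixes x v :: "'a::real_inner"
  assumes "l > 0" "x \<noteq> 0"
  shows "((\<lambda>t. radial_profile l \<gamma> a (norm (x + t *\<^sub>R v))) has_real_derivative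
    (a / (x \<bullet> x) + \<gamma> / 2) * (x \<bullet> v)) (at 0)"
proof -
  define S where "S = x \<bullet> x"
  have "S > 0" using assms(2) by (simp add: S_def)
  then have "((\<lambda>t. sqrt (S + 2 * t * (x \<bullet> v) + t * t * (v \<bullet> v))) has_real_derivative (x \<bullet> v) / sqrt S) (at 0)"
    by (auto intro!: derivative_eq_intros simp: field_simps)
  then have "((\<lambda>t. sqrt (x \<bullet> x + 2 * t * (x \<bullet> v) + t * t * (v \<bullet> v))) has_real_derivative (x \<bullet> v) / norm x) (at 0)"
    by (simp add: S_def norm_eq_sqrt_inner)
  moreover have "norm (x + t *\<^sub>R v) = sqrt (x \<bullet> x + 2 * t * (x \<bullet> v) + t * t * (v \<bullet> v))" for t
    unfolding norm_eq_sqrt_inner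
    by (simp add: inner_add_left inner_add_right inner_commute algebra_simps)
  ultimately have N: "((\<lambda>t. norm (x + t *\<^sub>R v)) has_real_derivative (x \<bullet> v) / norm x) (at 0)"
    by simp
  have "(radial_profile l \<gamma> a has_real_derivative a / norm x + \<gamma> * norm x / 2) (at (norm (x + 0 *\<^sub>R v)))"
    using radial_profile_has_real_derivative[of l "norm x"] assms by simp
  from DERIV_chain2[OF this N]
  show ?thesis
    using assms(2)
    by (simp add: dot_square_norm power2_eq_square field_simps)
qed

lemma radial_profile_partial_along_axis:
  fixes x :: "real^'n"
  assumes "x \<noteq> 0"
  shows "((\<lambda>t. (a / ((x + t *\<^sub>R axis i 1) \<bullet> (x + t *\<^sub>R axis i 1)) + \<gamma> / 2) * ((x + t *\<^sub>R axis i 1) \<bullet> axis i 1))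
    has_real_derivative a / (x \<bullet> x) - 2 * a * (x $ i)\<^sup>2 / (x \<bullet> x)\<^sup>2 + \<gamma> / 2) (at 0)"
proof -
  have *: "(x + t *\<^sub>R axis i 1) \<bullet> (x + t *\<^sub>R axis i 1) = x \<bullet> x + 2 * t * (x $ i) + t * t" for t
    by (simp add: inner_add_left inner_add_right inner_axis inner_axis_axis inner_commute[of "axis i 1"] algebra_simps)
  have **: "(x + t *\<^sub>R axis i 1) \<bullet> axis i 1 = x $ i + t" for t
    by (simp add: inner_axis)
  have "x \<bullet> x \<noteq> 0" using assms by simp
  then show ?thesis
    unfolding * **
    by (auto intro!: derivative_eq_intros simp: field_simps power2_eq_square)
qed

text \<open>The laplacian of the radial profile is \<open>\<gamma>\<close> only in dimension two; \<open>s = 1\<close> gives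
  \<open>\<psi>\<close> below the profile and \<open>s = -1\<close> above.\<close>

lemma comparison_with_radial_profile:
  fixes \<psi> :: "real^2 \<Rightarrow> real"
  assumes "open U" "bounded U" and psi: "C2_on U \<psi>" "continuous_on (closure U) \<psi>"
    and lap: "\<And>x. x \<in> U \<Longrightarrow> laplacian \<psi> x = \<gamma>"
    and "0 \<notin> closure U" "l > 0"
    and bdry: "\<And>x. x \<in> frontier U \<Longrightarrow> s * (\<psi> x - radial_profile l \<gamma> a (norm x)) \<le> 0"
    and "x \<in> closure U"
  shows "s * (\<psi> x - radial_profile l \<gamma> a (norm x)) \<le> 0"
proof (rule weak_maximum_principle[OF assms(1,2) _ _ _ _ bdry assms(9)])
  let ?d = "\<lambda>i x. s * (partial_deriv i \<psi> x - (a / (x \<bullet> x) + \<gamma> / 2) * (x \<bullet> axis i 1))"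
  let ?d2 = "\<lambda>i x. s * (partial_deriv i (partial_deriv i \<psi>) x
    - (a / (x \<bullet> x) - 2 * a * (x $ i)\<^sup>2 / (x \<bullet> x)\<^sup>2 + \<gamma> / 2))"
  have diff: "\<psi> differentiable (at y)" "partial_deriv i \<psi> differentiable (at y)" if "y \<in> U" for y i
    using psi(1) that \<open>open U\<close> unfolding C2_on_def differentiable_on_def by (metis at_within_open)+
  have nz: "y \<noteq> 0" if "y \<in> closure U" for y using that \<open>0 \<notin> closure U\<close> by blast
  show "continuous_on (closure U) (\<lambda>x. s * (\<psi> x - radial_profile l \<gamma> a (norm x)))"
    unfolding radial_profile_def using nz \<open>l > 0\<close>
    by (intro continuous_intros psi(2)) auto
  fix y assume y: "y \<in> U"
  then have "y \<noteq> 0" using nz closure_subset by blast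
  fix i
  show "((\<lambda>t. s * (\<psi> (y + t *\<^sub>R axis i 1) - radial_profile l \<gamma> a (norm (y + t *\<^sub>R axis i 1))))
      has_real_derivative ?d i y) (at 0)"
    by (intro DERIV_cmult DERIV_diff partial_deriv_along_axis diff y
        radial_profile_along_line \<open>l > 0\<close> \<open>y \<noteq> 0\<close>)
  show "((\<lambda>t. ?d i (y + t *\<^sub>R axis i 1)) has_real_derivative ?d2 i y) (at 0)"
    by (intro DERIV_cmult DERIV_diff partial_deriv_along_axis diff y
        radial_profile_partial_along_axis \<open>y \<noteq> 0\<close>)
next
  fix y :: "real^2" assume y: "y \<in> U"
  then have "y \<noteq> 0" using \<open>0 \<notin> closure U\<close> closure_subset by blast
  define S where "S = y \<bullet> y"
  have "S \<noteq> 0" using \<open>y \<noteq> 0\<close> by (simp add: S_def)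
  have "S = (y $ 1)\<^sup>2 + (y $ 2)\<^sup>2"
    by (simp add: S_def inner_vec_def sum_2 power2_eq_square)
  then have "2 * a * (y $ 1)\<^sup>2 / S\<^sup>2 + 2 * a * (y $ 2)\<^sup>2 / S\<^sup>2 = 2 * a * S / S\<^sup>2"
    by (simp add: add_divide_distrib algebra_simps)
  also have "\<dots> = 2 * a / S" using \<open>S \<noteq> 0\<close> by (simp add: power2_eq_square)
  finally have *: "2 * a * (y $ 1)\<^sup>2 / S\<^sup>2 + 2 * a * (y $ 2)\<^sup>2 / S\<^sup>2 = 2 * a / S" .
  have **: "partial_deriv 1 (partial_deriv 1 \<psi>) y + partial_deriv 2 (partial_deriv 2 \<psi>) y = \<gamma>"
    using lap[OF y] by (simp add: laplacian_def sum_2)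
  have "(\<Sum>i\<in>UNIV. s * (partial_deriv i (partial_deriv i \<psi>) y
    - (a / S - 2 * a * (y $ i)\<^sup>2 / S\<^sup>2 + \<gamma> / 2)))
    = s * ((partial_deriv 1 (partial_deriv 1 \<psi>) y + partial_deriv 2 (partial_deriv 2 \<psi>) y)
       - (2 * a / S - (2 * a * (y $ 1)\<^sup>2 / S\<^sup>2 + 2 * a * (y $ 2)\<^sup>2 / S\<^sup>2) + \<gamma>))"
    by (simp add: sum_2 algebra_simps)
  also have "\<dots> = 0" unfolding * ** by simp
  finally show "0 \<le> (\<Sum>i\<in>UNIV. s * (partial_deriv i (partial_deriv i \<psi>) y
    - (a / (y \<bullet> y) - 2 * a * (y $ i)\<^sup>2 / (y \<bullet> y)\<^sup>2 + \<gamma> / 2)))"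
    by (simp add: S_def)
qed

section \<open>The profile vanishing at a given radius and its slope there\<close>

definition vanishing_coeff :: "real \<Rightarrow> real \<Rightarrow> real \<Rightarrow> real" where
  "vanishing_coeff l \<gamma> R = - (1 + \<gamma> * (R\<^sup>2 - l\<^sup>2) / 4) / ln (R / l)"

lemma radial_profile_vanishing_coeff:
  assumes "0 < l" "l < R"
  shows "radial_profile l \<gamma> (vanishing_coeff l \<gamma> R) R = 0"
proof -
  have "ln (R / l) \<noteq> 0" using assms by auto
  then show ?thesis by (simp add: radial_profile_def vanishing_coeff_def)
qed

text \<open>The logarithm is positive beyond \<open>l\<close>, so the profile at \<open>R\<close>
  grows with its coefficient. This gives the boundary inequality for the upper barrier, whose
  coefficient is the largest on the outer boundary.\<close>

lemma radial_profile_nonneg: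
  assumes "0 < l" "l < R" "vanishing_coeff l \<gamma> R \<le> a"
  shows "0 \<le> radial_profile l \<gamma> a R"
proof -
  have "ln (R / l) > 0" using assms by auto
  then have "vanishing_coeff l \<gamma> R * ln (R / l) \<le> a * ln (R / l)"
    using assms by simp
  then show ?thesis
    using radial_profile_vanishing_coeff[OF assms(1,2), of \<gamma>] by (simp add: radial_profile_def)
qed

text \<open>With \<open>L = ln (r / l)\<close>, the derivative of the slope times
  \<open>r\<^sup>2 * L\<^sup>2\<close> equals \<open>(L + 1) + \<gamma> * (r\<^sup>2 * (2 *
  L\<^sup>2 - L + 1) - l\<^sup>2 * (L + 1)) / 4\<close>. The bracket is nonnegative because
  \<open>r\<^sup>2 = l\<^sup>2 * exp (2 * L)\<close> is at least
  \<open>l\<^sup>2 * (1 + 2 * L)\<close>.\<close>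

lemma vanishing_slope_strict_mono:
  assumes "0 < l" "l < R" "R < R'" "\<gamma> \<ge> 0"
  shows "vanishing_coeff l \<gamma> R / R + \<gamma> * R / 2 < vanishing_coeff l \<gamma> R' / R' + \<gamma> * R' / 2"
proof (rule DERIV_pos_imp_increasing[OF \<open>R < R'\<close>])
  fix r assume "R \<le> r" "r \<le> R'"
  then have r: "0 < l" "l < r" "0 < r" using assms by auto
  define L where "L = ln (r / l)"
  define N where "N = 1 + \<gamma> * (r\<^sup>2 - l\<^sup>2) / 4"
  have "L > 0" using r by (simp add: L_def)
  have "1 + 2 * L \<le> exp (2 * L)" by (rule exp_ge_add_one_self)
  also have "exp (2 * L) = (exp L)\<^sup>2" by (simp add: exp_double)
  also have "\<dots> = r\<^sup>2 / l\<^sup>2" using r by (simp add: L_def power_divide)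
  finally have le: "l\<^sup>2 * (1 + 2 * L) \<le> r\<^sup>2" using r by (simp add: field_simps)
  have "l\<^sup>2 * (L + 1) \<le> r\<^sup>2 * (2 * L\<^sup>2 - L + 1)"
  proof -
    have "l\<^sup>2 * (L + 1) * (1 + 2 * L) = (l\<^sup>2 * (1 + 2 * L)) * (L + 1)" by (simp add: algebra_simps)
    also have "\<dots> \<le> r\<^sup>2 * (L + 1)" using le \<open>L > 0\<close> by (intro mult_right_mono) auto
    also have "\<dots> \<le> r\<^sup>2 * (2 * L\<^sup>2 - L + 1) * (1 + 2 * L)"
    proof -
      \<comment> \<open>The product on the right expands to \<open>4 * L^3 + L + 1\<close>.\<close>
      have "L + 1 \<le> (2 * L\<^sup>2 - L + 1) * (1 + 2 * L)"
        using \<open>L > 0\<close> by (simp add: algebra_simps power2_eq_square)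
      then show ?thesis using mult_left_mono[of _ _ "r\<^sup>2"] by (simp add: mult.assoc)
    qed
    finally show ?thesis using \<open>L > 0\<close> by simp
  qed
  then have "\<gamma> * (r\<^sup>2 * (2 * L\<^sup>2 - L + 1) - l\<^sup>2 * (L + 1)) \<ge> 0"
    using \<open>\<gamma> \<ge> 0\<close> by simp
  moreover have "N * (L + 1) - \<gamma> * r\<^sup>2 * L / 2 + \<gamma> * r\<^sup>2 * L\<^sup>2 / 2
      = (L + 1) + \<gamma> * (r\<^sup>2 * (2 * L\<^sup>2 - L + 1) - l\<^sup>2 * (L + 1)) / 4"
    by (simp add: N_def field_simps)
  ultimately have "N * (L + 1) - \<gamma> * r\<^sup>2 * L / 2 + \<gamma> * r\<^sup>2 * L\<^sup>2 / 2 > 0"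
    using \<open>L > 0\<close> by simp
  then have pos: "(N * (L + 1) - \<gamma> * r\<^sup>2 * L / 2 + \<gamma> * r\<^sup>2 * L\<^sup>2 / 2) / (r\<^sup>2 * L\<^sup>2) > 0"
    using r \<open>L > 0\<close> by simp
  have lnd: "((\<lambda>r. ln (r / l)) has_real_derivative 1 / r) (at r)"
    using r by (auto intro!: derivative_eq_intros simp: field_simps)
  have "((\<lambda>r. - (1 + \<gamma> * (r\<^sup>2 - l\<^sup>2) / 4)) has_real_derivative - (\<gamma> * r / 2)) (at r)"
    by (auto intro!: derivative_eq_intros)
  from DERIV_divide[OF this lnd]
  have "(vanishing_coeff l \<gamma> has_real_derivative
      (- (\<gamma> * r / 2) * L - - N * (1 / r)) / (L * L)) (at r)"
    using \<open>L > 0\<close> unfolding vanishing_coeff_def[abs_def] L_def N_def by simp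
  from DERIV_divide[OF this DERIV_ident]
  have "((\<lambda>r. vanishing_coeff l \<gamma> r / r) has_real_derivative
      ((- (\<gamma> * r / 2) * L - - N * (1 / r)) / (L * L) * r - - N / L) / (r * r)) (at r)"
    using r by (simp add: vanishing_coeff_def L_def N_def)
  moreover have "((\<lambda>r. \<gamma> * r / 2) has_real_derivative \<gamma> / 2) (at r)"
    by (auto intro!: derivative_eq_intros)
  ultimately have der: "((\<lambda>r. vanishing_coeff l \<gamma> r / r + \<gamma> * r / 2) has_real_derivative
     ((- (\<gamma> * r / 2) * L - - N * (1 / r)) / (L * L) * r - - N / L) / (r * r) + \<gamma> / 2) (at r)"
    by (rule DERIV_add)
  have eq: "((- (\<gamma> * r / 2) * L - - N * (1 / r)) / (L * L) * r - - N / L) / (r * r) + \<gamma> / 2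
      = (N * (L + 1) - \<gamma> * r\<^sup>2 * L / 2 + \<gamma> * r\<^sup>2 * L\<^sup>2 / 2) / (r\<^sup>2 * L\<^sup>2)"
    using r \<open>L > 0\<close> by (simp add: field_simps power2_eq_square)
  show "\<exists>y. ((\<lambda>r. vanishing_coeff l \<gamma> r / r + \<gamma> * r / 2) has_real_derivative y) (at r) \<and> 0 < y"
    using der pos unfolding eq by blast
qed

section \<open>Inward normals and the gradient at the boundary\<close>

text \<open>The normal is that of the local graph, \<open>n - k *\<^sub>R e\<close> normalised, with
  \<open>k\<close> the slope of the graph at \<open>p\<close>. A direction with positive component
  along it rises above the graph to first order, hence enters the domain.\<close>

lemma C2_boundary_inward_normal:
  assumes "C2_boundary \<Omega>" "open \<Omega>" and p: "p \<in> frontier \<Omega>"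
  obtains \<nu> where "norm \<nu> = 1"
    "\<And>v. v \<bullet> \<nu> > 0 \<Longrightarrow> eventually (\<lambda>t. p + t *\<^sub>R v \<in> \<Omega>) (at_right 0)"
proof -
  obtain r e n \<phi> where "r > 0" and on: "norm e = 1" "norm n = 1" "e \<bullet> n = 0"
    and "C2_real \<phi>" and eq: "\<Omega> \<inter> ball p r = {x \<in> ball p r. \<phi> (x \<bullet> e) < x \<bullet> n}"
    using assms(1) p unfolding C2_boundary_def by blast
  then obtain \<phi>' where \<phi>': "\<And>t. (\<phi> has_real_derivative \<phi>' t) (at t)"
    unfolding C2_real_def by blast
  then have cont: "continuous_on UNIV \<phi>"
    by (meson DERIV_continuous_on has_field_derivative_at_within)
  define k where "k = \<phi>' (p \<bullet> e)"
  define m where "m = n - k *\<^sub>R e"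
  have "m \<bullet> n = 1"
    using on by (simp add: m_def inner_diff_left dot_square_norm)
  then have "m \<noteq> 0" by auto
  have "p \<notin> \<Omega>" "p \<in> closure \<Omega>"
    using p \<open>open \<Omega>\<close> by (auto simp: frontier_def interior_open)
  \<comment> \<open>The point \<open>p\<close> lies on the graph: strictly below it, a neighbourhood
    of \<open>p\<close> would miss the domain although \<open>p\<close> is in its closure; strictly
    above it, \<open>p\<close> would belong to the open domain.\<close>
  have "\<phi> (p \<bullet> e) = p \<bullet> n"
  proof (rule antisym)
    have "open {x. x \<bullet> n < \<phi> (x \<bullet> e)}"
      by (intro open_Collect_less continuous_intros continuous_on_compose2[OF cont]) auto
    then have op: "open ({x. x \<bullet> n < \<phi> (x \<bullet> e)} \<inter> ball p r)" by blast
    show "\<phi> (p \<bullet> e) \<le> p \<bullet> n"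
    proof (rule ccontr)
      assume "\<not> ?thesis"
      then have "p \<in> {x. x \<bullet> n < \<phi> (x \<bullet> e)} \<inter> ball p r" using \<open>r > 0\<close> by simp
      with \<open>p \<in> closure \<Omega>\<close> have "({x. x \<bullet> n < \<phi> (x \<bullet> e)} \<inter> ball p r) \<inter> \<Omega> \<noteq> {}"
        using open_Int_closure_eq_empty[OF op, of \<Omega>] by blast
      then obtain x where x: "x \<bullet> n < \<phi> (x \<bullet> e)" "x \<in> \<Omega> \<inter> ball p r" by blast
      from x(2) show False unfolding eq using x(1) by simp
    qed
    show "p \<bullet> n \<le> \<phi> (p \<bullet> e)"
    proof (rule ccontr)
      assume "\<not> ?thesis"
      then have "p \<in> {x \<in> ball p r. \<phi> (x \<bullet> e) < x \<bullet> n}" using \<open>r > 0\<close> by simp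
      then show False unfolding eq[symmetric] using \<open>p \<notin> \<Omega>\<close> by blast
    qed
  qed
  show thesis
  proof
    show "norm (m /\<^sub>R norm m) = 1" using \<open>m \<noteq> 0\<close> by simp
    fix v assume "v \<bullet> (m /\<^sub>R norm m) > 0"
    \<comment> \<open>This is the derivative at \<open>t = 0\<close> of the height of
      \<open>p + t *\<^sub>R v\<close> above the graph.\<close>
    then have pos: "v \<bullet> n - k * (v \<bullet> e) > 0"
      using \<open>m \<noteq> 0\<close> by (simp add: m_def inner_diff_right zero_less_mult_iff)
    have "((\<lambda>t. \<phi> (p \<bullet> e + t * (v \<bullet> e))) has_real_derivative k * (v \<bullet> e)) (at 0)"
      by (rule DERIV_chain2[of \<phi>]) (auto intro!: derivative_eq_intros \<phi>' simp: k_def)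
    then have "((\<lambda>t. (p \<bullet> n + t * (v \<bullet> n)) - \<phi> (p \<bullet> e + t * (v \<bullet> e))) has_real_derivative
        v \<bullet> n - k * (v \<bullet> e)) (at 0)"
      by (auto intro!: derivative_eq_intros)
    from DERIV_pos_inc_right[OF this pos] \<open>\<phi> (p \<bullet> e) = p \<bullet> n\<close>
    obtain d where "d > 0"
      "\<And>t. 0 < t \<Longrightarrow> t < d \<Longrightarrow> 0 < (p \<bullet> n + t * (v \<bullet> n)) - \<phi> (p \<bullet> e + t * (v \<bullet> e))"
      by auto
    then have ev1: "eventually (\<lambda>t. 0 < (p \<bullet> n + t * (v \<bullet> n)) - \<phi> (p \<bullet> e + t * (v \<bullet> e))) (at_right 0)"
      unfolding eventually_at_right_field by blast
    have "((\<lambda>t. p + t *\<^sub>R v) \<longlongrightarrow> p) (at_right 0)"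
      by (auto intro!: tendsto_eq_intros)
    then have "eventually (\<lambda>t. p + t *\<^sub>R v \<in> ball p r) (at_right 0)"
      using \<open>r > 0\<close> by (intro topological_tendstoD) auto
    with ev1 show "eventually (\<lambda>t. p + t *\<^sub>R v \<in> \<Omega>) (at_right 0)"
    proof eventually_elim
      case (elim t)
      then have "p + t *\<^sub>R v \<in> {x \<in> ball p r. \<phi> (x \<bullet> e) < x \<bullet> n}"
        by (simp add: inner_add_left)
      then show ?case using eq by blast
    qed
  qed
qed

text \<open>\<open>grad_closure\<close> is a \<open>Lim\<close>, which is informative only once a
  limit is known to exist. The continuous extensions of the partial derivatives provide it, and
  \<open>p\<close>, being in the closure but outside \<open>U\<close>, is a limit point of
  \<open>U\<close>, which makes it unique.\<close>

lemma grad_tendsto_grad_closure: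
  fixes f :: "real^'n \<Rightarrow> real"
  assumes "C2_closure U f" "p \<in> closure U" "p \<notin> U"
  shows "(grad f \<longlongrightarrow> grad_closure U f p) (at p within U)"
proof -
  obtain g where g: "\<And>i. continuous_on (closure U) (g i)" "\<And>i x. x \<in> U \<Longrightarrow> g i x = partial_deriv i f x"
    using assms(1) unfolding C2_closure_def extends_continuously_def by metis
  have "(grad f \<longlongrightarrow> (\<chi> i. g i p)) (at p within U)"
  proof (rule vec_tendstoI)
    fix i
    have "(g i \<longlongrightarrow> g i p) (at p within U)"
      using g(1)[of i] assms(2) closure_subset
      by (meson continuous_on_def tendsto_within_subset)
    moreover have "eventually (\<lambda>x. g i x = grad f x $ i) (at p within U)"
      unfolding eventually_at_filter by (simp add: g(2) grad_def)
    ultimately show "((\<lambda>x. grad f x $ i) \<longlongrightarrow> (\<chi> i. g i p) $ i) (at p within U)"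
      using Lim_transform_eventually by fastforce
  qed
  moreover have "at p within U \<noteq> bot"
    using assms(2,3) by (simp add: at_within_eq_bot_iff)
  ultimately show ?thesis
    unfolding grad_closure_def using tendsto_Lim by metis
qed

text \<open>Testing the nonnegative derivative against the directions \<open>\<epsilon> \<nu> - \<tau>\<close>, where \<open>\<tau>\<close>
  is the tangential part of \<open>G\<close>, forces \<open>\<tau> = 0\<close>.\<close>

lemma norm_eq_normal_component:
  fixes G \<nu> :: "'a::real_inner"
  assumes "norm \<nu> = 1" and half: "\<And>v. v \<bullet> \<nu> > 0 \<Longrightarrow> G \<bullet> v \<ge> 0"
  shows "norm G = G \<bullet> \<nu>"
proof -
  have nn: "\<nu> \<bullet> \<nu> = 1" using assms(1) by (simp add: dot_square_norm)
  define c where "c = G \<bullet> \<nu>"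
  define \<tau> where "\<tau> = G - c *\<^sub>R \<nu>"
  have "c \<ge> 0" using half[of \<nu>] nn by (simp add: c_def)
  have tn: "\<tau> \<bullet> \<nu> = 0" by (simp add: \<tau>_def inner_diff_left nn c_def)
  have "G \<bullet> \<tau> = (\<tau> + c *\<^sub>R \<nu>) \<bullet> \<tau>" by (simp add: \<tau>_def)
  also have "\<dots> = \<tau> \<bullet> \<tau>" using tn by (simp add: inner_add_left inner_commute[of \<nu>])
  finally have "G \<bullet> \<tau> = \<tau> \<bullet> \<tau>" .
  have "\<tau> \<bullet> \<tau> \<le> 0 + e" if "e > 0" for e
  proof -
    \<comment> \<open>The \<open>+ 1\<close> keeps the quotient meaningful when
      \<open>c = 0\<close>.\<close>
    define \<epsilon> where "\<epsilon> = e / (c + 1)"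
    have "\<epsilon> > 0" "\<epsilon> * c \<le> e" using \<open>e > 0\<close> \<open>c \<ge> 0\<close> by (simp_all add: \<epsilon>_def field_simps)
    have "0 \<le> G \<bullet> (\<epsilon> *\<^sub>R \<nu> - \<tau>)"
      by (rule half) (simp add: inner_diff_left tn nn \<open>\<epsilon> > 0\<close>)
    also have "\<dots> = \<epsilon> * c - \<tau> \<bullet> \<tau>" by (simp add: inner_diff_right \<open>G \<bullet> \<tau> = \<tau> \<bullet> \<tau>\<close> c_def)
    finally show ?thesis using \<open>\<epsilon> * c \<le> e\<close> by simp
  qed
  then have "\<tau> \<bullet> \<tau> \<le> 0" by (rule field_le_epsilon)
  then have "\<tau> = 0" by (metis antisym inner_eq_zero_iff inner_ge_zero)
  then have "G = c *\<^sub>R \<nu>" by (simp add: \<tau>_def)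
  then have "norm G = c" using \<open>c \<ge> 0\<close> \<open>norm \<nu> = 1\<close> by simp
  then show ?thesis by (simp add: c_def)
qed

section \<open>Symmetry of the domain and of a given solution\<close>

lemma positive_solution_radial:
  fixes \<Omega> :: "(real^2) set"
  assumes "l > 0" "\<gamma> \<ge> 0" "open \<Omega>" "connected \<Omega>" "bounded \<Omega>" "C2_boundary \<Omega>"
    and cb: "cball 0 l \<subseteq> \<Omega>" and "Q > 0" and sol: "positive_solution l \<gamma> \<Omega> Q \<psi>"
  shows "\<exists>R>l. \<Omega> = ball 0 R \<and> radially_decreasing_on (closure (\<Omega> - ball 0 l)) \<psi>"
proof -
  define U where "U = \<Omega> - cball 0 l"
  let ?V = "radial_profile l \<gamma>" and ?A = "vanishing_coeff l \<gamma>"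
  define slope where "slope R = ?A R / R + \<gamma> * R / 2" for R
  define G where "G = grad_closure U \<psi>"
  have C2: "C2_closure U \<psi>" and lap: "\<And>x. x \<in> U \<Longrightarrow> laplacian \<psi> x = \<gamma>"
    and zero: "\<And>x. x \<in> frontier \<Omega> \<Longrightarrow> \<psi> x = 0"
    and "\<And>x. x \<in> frontier (ball 0 l) \<Longrightarrow> \<psi> x = 1"
    and GQ: "\<And>x. x \<in> frontier \<Omega> \<Longrightarrow> (norm (G x))\<^sup>2 = Q"
    and pos: "\<And>x. x \<in> U \<Longrightarrow> \<psi> x > 0"
    using sol unfolding positive_solution_def U_def G_def by auto
  then have one: "\<And>x. norm x = l \<Longrightarrow> \<psi> x = 1"
    using \<open>l > 0\<close> by (simp add: frontier_ball)
  have G_norm: "norm (G x) = sqrt Q" if "x \<in> frontier \<Omega>" for x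
    using GQ[OF that] by (metis norm_ge_zero real_sqrt_unique)
  have "sqrt Q > 0" using \<open>Q > 0\<close> by simp
  have "C2_on U \<psi>" and cont: "continuous_on (closure U) \<psi>" and diff: "\<psi> differentiable_on U"
    using C2 unfolding C2_closure_def C2_on_def by auto
  have "open U" "bounded U" using assms by (auto simp: U_def open_Diff bounded_diff)
  have "0 \<in> \<Omega>" using cb \<open>l > 0\<close> by (metis centre_in_cball less_imp_le subsetD)
  have fr: "x \<notin> \<Omega>" "x \<in> closure \<Omega>" "norm x > l" if "x \<in> frontier \<Omega>" for x
  proof -
    show "x \<notin> \<Omega>" "x \<in> closure \<Omega>"
      using that \<open>open \<Omega>\<close> by (auto simp: frontier_def interior_open)
    then show "norm x > l" using cb by (meson mem_cball_0 not_le subsetD)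
  qed
  have clU: "norm x \<ge> l" "x \<in> closure \<Omega>" if "x \<in> closure U" for x
  proof -
    have "closure U \<subseteq> {x. norm x \<ge> l}"
      by (rule closure_minimal) (auto simp: U_def intro!: closed_Collect_le continuous_intros)
    then show "norm x \<ge> l" using that by blast
    show "x \<in> closure \<Omega>" using that closure_mono[of U \<Omega>] by (auto simp: U_def)
  qed
  then have clU_cases: "x \<in> U \<or> norm x = l \<or> x \<in> frontier \<Omega>" if "x \<in> closure U" for x
    using that \<open>open \<Omega>\<close> by (fastforce simp: U_def frontier_def interior_open)
  have fr_U: "x \<in> closure U" "x \<notin> U" if "x \<in> frontier \<Omega>" for x
  proof -
    have op: "open (- cball 0 l :: (real^2) set)" by (intro open_Compl closed_cball)
    have "closure \<Omega> \<inter> (- cball 0 l) \<subseteq> closure (\<Omega> \<inter> (- cball 0 l))"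
      using open_Int_closure_subset[OF op, of \<Omega>] by (simp add: Int_commute)
    then show "x \<in> closure U"
      using fr[OF that] by (auto simp: U_def Diff_eq)
    show "x \<notin> U" using fr[OF that] by (simp add: U_def)
  qed
  have quotient: "((\<lambda>t. \<psi> (p + t *\<^sub>R v) / t) \<longlongrightarrow> G p \<bullet> v) (at_right 0)"
    if p: "p \<in> frontier \<Omega>" and ev: "eventually (\<lambda>t. p + t *\<^sub>R v \<in> U) (at_right 0)" for p v
    using directional_quotient_tendsto[OF \<open>open U\<close> cont diff grad_tendsto_grad_closure[OF C2] _ _ ev]
      fr_U[OF p] zero[OF p] by (simp add: G_def)
  \<comment> \<open>The limit is the radial slope at \<open>norm p\<close> times the component of
    \<open>v\<close> along the unit vector of \<open>p\<close>.\<close>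
  have profile_quotient: "((\<lambda>t. ?V a (norm (p + t *\<^sub>R v)) / t) \<longlongrightarrow>
      (a / norm p + \<gamma> * norm p / 2) * ((p \<bullet> v) / norm p)) (at_right 0)"
    if "p \<in> frontier \<Omega>" "?V a (norm p) = 0" for a p v
  proof -
    have "p \<noteq> 0" using fr(3)[OF that(1)] \<open>l > 0\<close> by auto
    have "((\<lambda>t. ?V a (norm (p + t *\<^sub>R v)) / t) \<longlongrightarrow> (a / (p \<bullet> p) + \<gamma> / 2) * (p \<bullet> v)) (at 0)"
      using radial_profile_along_line[OF \<open>l > 0\<close> \<open>p \<noteq> 0\<close>, of \<gamma> a v] that(2)
      by (simp add: DERIV_def)
    moreover have "(a / (p \<bullet> p) + \<gamma> / 2) * (p \<bullet> v) =
        (a / norm p + \<gamma> * norm p / 2) * ((p \<bullet> v) / norm p)"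
      using \<open>p \<noteq> 0\<close> by (simp add: dot_square_norm power2_eq_square field_simps)
    ultimately show ?thesis
      by (simp add: filterlim_at_split)
  qed
  have compF: "compact (frontier \<Omega>)" using \<open>bounded \<Omega>\<close> by (simp add: compact_frontier_bounded)
  have "\<Omega> \<noteq> UNIV" using \<open>bounded \<Omega>\<close> not_bounded_UNIV by blast
  then have neF: "frontier \<Omega> \<noteq> {}"
    using frontier_eq_empty \<open>0 \<in> \<Omega>\<close> by blast

  \<comment> \<open>Lower barrier in the disk up to the nearest boundary point\<close>
  obtain p1 where p1: "p1 \<in> frontier \<Omega>" "\<And>x. x \<in> frontier \<Omega> \<Longrightarrow> norm p1 \<le> norm x"
    using continuous_attains_inf[OF compF neF continuous_on_norm_id] by blast
  define R1 where "R1 = norm p1"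
  have "l < R1" using fr p1 by (simp add: R1_def)
  \<comment> \<open>A disk meeting the domain but not contained in it would, being connected, meet
    the frontier at a norm below the minimum \<open>R1\<close>.\<close>
  have ball_sub: "ball 0 R1 \<subseteq> \<Omega>"
  proof (rule ccontr)
    assume "\<not> ?thesis"
    then have "ball 0 R1 \<inter> frontier \<Omega> \<noteq> {}"
    proof (intro connected_Int_frontier)
      have "0 \<in> ball 0 R1 \<inter> \<Omega>" using \<open>0 \<in> \<Omega>\<close> \<open>l > 0\<close> \<open>l < R1\<close> by simp
      then show "ball 0 R1 \<inter> \<Omega> \<noteq> {}" by blast
    qed auto
    then obtain y where "y \<in> frontier \<Omega>" "norm y < R1" by auto
    then show False using p1(2)[of y] by (simp add: R1_def)
  qed
  have lower: "?V (?A R1) (norm x) \<le> \<psi> x" if "l \<le> norm x" "norm x < R1" for x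
  proof -
    define U1 where "U1 = ball 0 R1 - cball (0::real^2) l"
    have "U1 \<subseteq> U" using ball_sub by (auto simp: U1_def U_def)
    have "open U1" "bounded U1" by (auto simp: U1_def open_Diff bounded_diff)
    have clU1: "l \<le> norm x \<and> norm x \<le> R1" if "x \<in> closure U1" for x
    proof -
      have "closure U1 \<subseteq> {x. l \<le> norm x} \<inter> {x. norm x \<le> R1}"
        by (rule closure_minimal)
          (auto simp: U1_def intro!: closed_Collect_le closed_Int continuous_intros)
      then show ?thesis using that by blast
    qed
    have "- 1 * (\<psi> x - ?V (?A R1) (norm x)) \<le> 0" if "x \<in> closure U1" for x
    proof (rule comparison_with_radial_profile[OF \<open>open U1\<close> \<open>bounded U1\<close> _ _ _ _ \<open>l > 0\<close> _ that])
      show "C2_on U1 \<psi>"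
        using \<open>C2_on U \<psi>\<close> \<open>U1 \<subseteq> U\<close> unfolding C2_on_def
        by (meson continuous_on_subset differentiable_on_subset)
      show "continuous_on (closure U1) \<psi>"
        using cont closure_mono[OF \<open>U1 \<subseteq> U\<close>] by (rule continuous_on_subset)
      show "laplacian \<psi> x = \<gamma>" if "x \<in> U1" for x
        using lap that \<open>U1 \<subseteq> U\<close> by blast
      show "0 \<notin> closure U1" using clU1[of 0] \<open>l > 0\<close> by auto
      fix x assume x: "x \<in> frontier U1"
      then have x': "x \<in> closure U1" "x \<notin> U1"
        using \<open>open U1\<close> by (auto simp: frontier_def interior_open)
      then have "norm x = l \<or> norm x = R1"
        using clU1[of x] by (auto simp: U1_def)
      \<comment> \<open>Points of the circle of radius \<open>R1\<close> may lie in the domain or on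
        its frontier; in both cases \<open>\<psi>\<close> is at least 0, the value of the profile
        there.\<close>
      moreover have "\<psi> x \<ge> 0"
      proof -
        have "x \<in> closure U" using closure_mono[OF \<open>U1 \<subseteq> U\<close>] x' by blast
        then show ?thesis using clU_cases[of x] pos[of x] one[of x] zero[of x] by fastforce
      qed
      ultimately show "- 1 * (\<psi> x - ?V (?A R1) (norm x)) \<le> 0"
        using one[of x] \<open>l > 0\<close> \<open>l < R1\<close> by (auto simp: radial_profile_vanishing_coeff)
    qed
    moreover have "x \<in> closure U1"
    proof -
      have op: "open (ball 0 R1 :: (real^2) set)" by simp
      have "ball 0 R1 \<inter> closure (- cball 0 l) \<subseteq> closure (ball 0 R1 \<inter> - cball (0::real^2) l)"
        by (rule open_Int_closure_subset[OF op])
      moreover have "x \<in> closure (- cball 0 l)"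
        using \<open>l \<le> norm x\<close> \<open>l > 0\<close> by (simp add: closure_complement interior_cball)
      ultimately show ?thesis using \<open>norm x < R1\<close> by (auto simp: U1_def Diff_eq)
    qed
    ultimately show ?thesis by force
  qed
  have slope1: "- slope R1 \<le> sqrt Q"
  proof -
    \<comment> \<open>Moving from \<open>p1\<close> towards the origin stays in the disk where
      \<open>lower\<close> holds. Cauchy-Schwarz bounds the directional derivative of
      \<open>\<psi>\<close> by \<open>sqrt Q\<close>, so \<open>v\<close> need not be identified
      with the normal.\<close>
    define v where "v = - (p1 /\<^sub>R R1)"
    have "R1 > 0" using \<open>l > 0\<close> \<open>l < R1\<close> by simp
    have "norm v = 1" using \<open>R1 > 0\<close> by (simp add: v_def R1_def)
    have "eventually (\<lambda>t. 0 < t \<and> t < R1 - l) (at_right 0)"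
      using eventually_at_right_real[of 0 "R1 - l"] \<open>l < R1\<close> by (auto elim: eventually_mono)
    then have ev: "eventually (\<lambda>t. 0 < t \<and> l \<le> norm (p1 + t *\<^sub>R v) \<and> norm (p1 + t *\<^sub>R v) < R1 \<and> p1 + t *\<^sub>R v \<in> U) (at_right 0)"
    proof eventually_elim
      case (elim t)
      have "p1 + t *\<^sub>R v = (1 - t / R1) *\<^sub>R p1"
        by (simp add: v_def algebra_simps divide_inverse)
      then have "norm (p1 + t *\<^sub>R v) = \<bar>1 - t / R1\<bar> * R1" by (simp add: R1_def)
      also have "\<dots> = R1 - t" using elim \<open>l > 0\<close> \<open>R1 > 0\<close> by (simp add: abs_if field_simps)
      finally have n: "norm (p1 + t *\<^sub>R v) = R1 - t" .
      then have "p1 + t *\<^sub>R v \<in> U" using ball_sub elim by (auto simp: U_def)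
      then show ?case using n elim by simp
    qed
    have "eventually (\<lambda>t. ?V (?A R1) (norm (p1 + t *\<^sub>R v)) / t \<le> \<psi> (p1 + t *\<^sub>R v) / t) (at_right 0)"
      using ev by eventually_elim (auto intro!: divide_right_mono lower)
    moreover have "((\<lambda>t. ?V (?A R1) (norm (p1 + t *\<^sub>R v)) / t) \<longlongrightarrow> slope R1 * ((p1 \<bullet> v) / R1)) (at_right 0)"
      using profile_quotient[OF p1(1), of "?A R1" v] \<open>l > 0\<close> \<open>l < R1\<close>
      by (simp add: R1_def slope_def radial_profile_vanishing_coeff)
    moreover have "((\<lambda>t. \<psi> (p1 + t *\<^sub>R v) / t) \<longlongrightarrow> G p1 \<bullet> v) (at_right 0)"
      by (rule quotient[OF p1(1)]) (use ev in \<open>auto elim: eventually_mono\<close>)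
    ultimately have "slope R1 * ((p1 \<bullet> v) / R1) \<le> G p1 \<bullet> v"
      by (intro tendsto_le[OF trivial_limit_at_right_real])
    moreover have "(p1 \<bullet> v) / R1 = - 1"
      using \<open>R1 > 0\<close> by (simp add: v_def R1_def dot_square_norm power2_eq_square)
    moreover have "G p1 \<bullet> v \<le> sqrt Q"
      using norm_cauchy_schwarz[of "G p1" v] G_norm[OF p1(1)] \<open>norm v = 1\<close> by simp
    ultimately show ?thesis by simp
  qed

  \<comment> \<open>Upper barrier and the farthest boundary point\<close>
  have compC: "compact (closure \<Omega>)" using \<open>bounded \<Omega>\<close> by (simp add: compact_closure)
  have neC: "closure \<Omega> \<noteq> {}" using \<open>0 \<in> \<Omega>\<close> by auto
  obtain p2 where p2: "p2 \<in> closure \<Omega>" "\<And>x. x \<in> closure \<Omega> \<Longrightarrow> norm x \<le> norm p2"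
    using continuous_attains_sup[OF compC neC continuous_on_norm_id] by blast
  define R2 where "R2 = norm p2"
  \<comment> \<open>The inequality is strict because an open set inside the closed disk lies in its
    interior.\<close>
  have sub_ball: "norm x < R2" if "x \<in> \<Omega>" for x
  proof -
    have "\<Omega> \<subseteq> cball 0 R2" using p2(2) closure_subset[of \<Omega>] by (auto simp: R2_def)
    then have "\<Omega> \<subseteq> ball 0 R2"
      using interior_maximal[OF _ \<open>open \<Omega>\<close>, of "cball 0 R2"] by (simp add: interior_cball)
    then show ?thesis using that by auto
  qed
  have "R1 \<le> R2" using p2(2)[of p1] fr(2)[OF p1(1)] by (simp add: R1_def R2_def)
  have all_norms: "\<exists>x\<in>U. norm x = r" if "l < r" "r < R2" for r
  proof -
    have "p2 \<in> closure \<Omega> \<inter> {x. r < norm x}" using p2 that by (simp add: R2_def)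
    moreover have "open {x::real^2. r < norm x}"
      by (intro open_Collect_less continuous_intros)
    ultimately obtain y where y: "y \<in> \<Omega>" "r < norm y"
      using open_Int_closure_eq_empty[of "{x::real^2. r < norm x}" \<Omega>] by blast
    have "connected (norm ` \<Omega>)"
      using \<open>connected \<Omega>\<close> by (intro connected_continuous_image continuous_intros)
    moreover have "0 \<in> norm ` \<Omega>" "norm y \<in> norm ` \<Omega>" using \<open>0 \<in> \<Omega>\<close> y by force+
    ultimately have "r \<in> norm ` \<Omega>"
      using connectedD_interval[of "norm ` \<Omega>" 0 "norm y" r] that y \<open>l > 0\<close> by simp
    then show ?thesis using that by (auto simp: U_def)
  qed
  have "continuous_on (frontier \<Omega>) (\<lambda>x. ?A (norm x))"
  proof -
    have "ln (norm x / l) \<noteq> 0" "norm x / l \<noteq> 0" if "x \<in> frontier \<Omega>" for x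
    proof -
      have "norm x / l > 1" using fr(3)[OF that] \<open>l > 0\<close> by simp
      then have "ln (norm x / l) > 0" by (rule ln_gt_zero)
      then show "ln (norm x / l) \<noteq> 0" by simp
      show "norm x / l \<noteq> 0" using \<open>norm x / l > 1\<close> by linarith
    qed
    then show ?thesis unfolding vanishing_coeff_def using \<open>l > 0\<close>
      by (intro continuous_intros) auto
  qed
  \<comment> \<open>The point maximises the coefficient, not the norm: for positive
    \<open>\<gamma>\<close> the coefficient tends to minus infinity both as the radius decreases to
    \<open>l\<close> and as it grows without bound, so it is not monotone in the radius.\<close>
  then obtain p where p: "p \<in> frontier \<Omega>" "\<And>x. x \<in> frontier \<Omega> \<Longrightarrow> ?A (norm x) \<le> ?A (norm p)"
    using continuous_attains_sup[OF compF neF] by blast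
  define a where "a = ?A (norm p)"
  have Vp: "?V a (norm p) = 0"
    using fr(3)[OF p(1)] \<open>l > 0\<close> by (simp add: a_def radial_profile_vanishing_coeff)
  have upper: "\<psi> x \<le> ?V a (norm x)" if "x \<in> closure U" for x
  proof -
    have "1 * (\<psi> x - ?V a (norm x)) \<le> 0"
    proof (rule comparison_with_radial_profile[OF \<open>open U\<close> \<open>bounded U\<close> \<open>C2_on U \<psi>\<close> cont lap _ \<open>l > 0\<close> _ that])
      show "0 \<notin> closure U" using clU(1)[of 0] \<open>l > 0\<close> by auto
      fix x assume "x \<in> frontier U"
      then have "norm x = l \<or> x \<in> frontier \<Omega>"
        using clU_cases[of x] \<open>open U\<close> by (auto simp: frontier_def interior_open)
      then show "1 * (\<psi> x - ?V a (norm x)) \<le> 0"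
        using one[of x] zero[of x] fr(3)[of x] p(2)[of x] \<open>l > 0\<close> radial_profile_nonneg[of l "norm x" \<gamma> a]
        by (auto simp: a_def)
    qed
    then show ?thesis by simp
  qed
  have "norm p = R2"
  proof (rule ccontr)
    assume "norm p \<noteq> R2"
    then have "norm p < R2" using p2(2)[of p] fr(2)[OF p(1)] by (simp add: R2_def)
    then obtain x where x: "x \<in> U" "norm x = norm p" using all_norms fr(3)[OF p(1)] by blast
    then have "\<psi> x \<le> 0" using upper[of x] Vp closure_subset[of U] by auto
    then show False using pos[OF x(1)] by simp
  qed
  have a: "a = ?A R2" using \<open>norm p = R2\<close> by (simp add: a_def)
  have "l < R2" using \<open>l < R1\<close> \<open>R1 \<le> R2\<close> by simp
  have slope2: "sqrt Q \<le> - slope R2"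
  proof -
    have "R2 > 0" using \<open>l < R2\<close> \<open>l > 0\<close> by simp
    obtain \<nu> where \<nu>: "norm \<nu> = 1"
      "\<And>v. v \<bullet> \<nu> > 0 \<Longrightarrow> eventually (\<lambda>t. p + t *\<^sub>R v \<in> \<Omega>) (at_right 0)"
      using C2_boundary_inward_normal[OF \<open>C2_boundary \<Omega>\<close> \<open>open \<Omega>\<close> p(1)] by blast
    have inU: "eventually (\<lambda>t. p + t *\<^sub>R v \<in> U \<and> 0 < t) (at_right 0)" if "v \<bullet> \<nu> > 0" for v
    proof -
      have "((\<lambda>t. p + t *\<^sub>R v) \<longlongrightarrow> p) (at_right 0)"
        by (auto intro!: tendsto_eq_intros)
      moreover have "open (- cball 0 l :: (real^2) set)" by (intro open_Compl closed_cball)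
      moreover have "p \<in> - cball 0 l"
        using fr(3)[OF p(1)] by auto
      ultimately have "eventually (\<lambda>t. p + t *\<^sub>R v \<in> - cball 0 l) (at_right 0)"
        using topological_tendstoD by blast
      with \<nu>(2)[OF that] eventually_at_right_less[of 0] show ?thesis
        by eventually_elim (auto simp: U_def)
    qed
    have lim: "((\<lambda>t. \<psi> (p + t *\<^sub>R v) / t) \<longlongrightarrow> G p \<bullet> v) (at_right 0)" if "v \<bullet> \<nu> > 0" for v
      by (rule quotient[OF p(1)]) (use inU[OF that] in \<open>auto elim: eventually_mono\<close>)
    \<comment> \<open>Since \<open>\<psi>\<close> vanishes at \<open>p\<close> and is positive
      inside, its quotients in all inward directions are nonnegative; this makes the whole gradient
      at \<open>p\<close> normal.\<close>
    have "G p \<bullet> v \<ge> 0" if "v \<bullet> \<nu> > 0" for v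
    proof (rule tendsto_lowerbound[OF lim[OF that]])
      show "eventually (\<lambda>t. 0 \<le> \<psi> (p + t *\<^sub>R v) / t) (at_right 0)"
        using inU[OF that] by eventually_elim (auto intro!: divide_nonneg_pos less_imp_le[OF pos])
    qed simp
    then have "norm (G p) = G p \<bullet> \<nu>" by (rule norm_eq_normal_component[OF \<nu>(1)])
    then have G: "G p \<bullet> \<nu> = sqrt Q" using G_norm[OF p(1)] by simp
    have "\<nu> \<bullet> \<nu> > 0" using \<nu>(1) by (simp add: dot_square_norm)
    \<comment> \<open>This is the cosine of the angle between \<open>p\<close> and the inward
      normal. It suffices that \<open>c\<close> is negative and at least -1: the bound
      \<open>sqrt Q \<le> slope R2 * c\<close> then forces \<open>slope R2 < 0\<close>, whence
      \<open>slope R2 * c \<le> - slope R2\<close>.\<close>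
    define c where "c = (p \<bullet> \<nu>) / R2"
    have "eventually (\<lambda>t. \<psi> (p + t *\<^sub>R \<nu>) / t \<le> ?V a (norm (p + t *\<^sub>R \<nu>)) / t) (at_right 0)"
      using inU[OF \<open>\<nu> \<bullet> \<nu> > 0\<close>]
      by eventually_elim (use upper closure_subset in \<open>auto intro!: divide_right_mono\<close>)
    moreover have "((\<lambda>t. ?V a (norm (p + t *\<^sub>R \<nu>)) / t) \<longlongrightarrow> slope R2 * c) (at_right 0)"
      using profile_quotient[OF p(1) Vp, of \<nu>] unfolding \<open>norm p = R2\<close> slope_def a c_def .
    ultimately have le: "sqrt Q \<le> slope R2 * c"
      using lim[OF \<open>\<nu> \<bullet> \<nu> > 0\<close>] unfolding G
      by (intro tendsto_le[OF trivial_limit_at_right_real])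
    \<comment> \<open>A single inward point \<open>p + t *\<^sub>R \<nu>\<close> of norm below
      \<open>norm p\<close> gives the sign of \<open>p \<bullet> \<nu>\<close> after expanding the
      square.\<close>
    have "eventually (\<lambda>t. p + t *\<^sub>R \<nu> \<in> U \<and> 0 < t) (at_right (0::real))" by (rule inU) fact
    then obtain t :: real where t: "p + t *\<^sub>R \<nu> \<in> \<Omega>" "0 < t"
      using eventually_happens'[OF trivial_limit_at_right_real] by (auto simp: U_def)
    then have "norm (p + t *\<^sub>R \<nu>) < norm p" using sub_ball \<open>norm p = R2\<close> by simp
    then have "(p + t *\<^sub>R \<nu>) \<bullet> (p + t *\<^sub>R \<nu>) < p \<bullet> p" by (simp add: norm_lt)
    then have "t * (2 * (p \<bullet> \<nu>) + t * (\<nu> \<bullet> \<nu>)) < 0"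
      by (simp add: inner_add_left inner_add_right inner_commute algebra_simps)
    then have "2 * (p \<bullet> \<nu>) + t * (\<nu> \<bullet> \<nu>) < 0" using \<open>t > 0\<close> by (simp add: mult_less_0_iff)
    then have "p \<bullet> \<nu> < 0"
      using \<open>t > 0\<close> \<open>\<nu> \<bullet> \<nu> > 0\<close> mult_pos_pos[of t "\<nu> \<bullet> \<nu>"] by linarith
    then have "c < 0" using \<open>R2 > 0\<close> by (simp add: c_def divide_neg_pos)
    have "\<bar>c\<bar> \<le> 1"
      using Cauchy_Schwarz_ineq2[of p \<nu>] \<nu>(1) \<open>norm p = R2\<close> \<open>R2 > 0\<close> by (simp add: c_def abs_divide)
    have "slope R2 < 0"
      using le \<open>sqrt Q > 0\<close> \<open>c < 0\<close> by (smt (verit) mult_nonneg_nonpos)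
    have "slope R2 * c \<le> - slope R2"
      using mult_left_mono[of "- c" 1 "- slope R2"] \<open>slope R2 < 0\<close> \<open>\<bar>c\<bar> \<le> 1\<close> by simp
    then show ?thesis using le by simp
  qed

  \<comment> \<open>Equality of the radii and radial monotonicity\<close>
  \<comment> \<open>Otherwise
    \<open>slope R1 < slope R2 \<le> - sqrt Q \<le> slope R1\<close>.\<close>
  have "R1 = R2"
    using vanishing_slope_strict_mono[OF \<open>l > 0\<close> \<open>l < R1\<close> _ \<open>\<gamma> \<ge> 0\<close>, of R2] slope1 slope2 \<open>R1 \<le> R2\<close>
    by (force simp: slope_def)
  have Om: "\<Omega> = ball 0 R2"
    using ball_sub sub_ball \<open>R1 = R2\<close> by auto
  have decr: "?V a r' < ?V a r" if "l \<le> r" "r < r'" "r' \<le> R2" for r r'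
  proof (rule DERIV_neg_imp_decreasing[OF \<open>r < r'\<close>])
    fix s assume s: "r \<le> s" "s \<le> r'"
    then have "0 < s" "s \<le> R2" using that \<open>l > 0\<close> by auto
    \<comment> \<open>The derivative of the profile times \<open>s\<close> is
      \<open>a + \<gamma> * s\<^sup>2 / 2\<close>, which is nondecreasing in \<open>s\<close>, so
      its negative sign at \<open>R2\<close> carries over to all smaller radii.\<close>
    have "a + \<gamma> * s\<^sup>2 / 2 \<le> a + \<gamma> * R2\<^sup>2 / 2"
      using \<open>0 < s\<close> \<open>s \<le> R2\<close> \<open>\<gamma> \<ge> 0\<close> by (simp add: mult_left_mono power_mono)
    also have "\<dots> = R2 * slope R2"
      using \<open>0 < s\<close> \<open>s \<le> R2\<close> by (simp add: slope_def a field_simps power2_eq_square)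
    also have "\<dots> < 0"
    proof (rule mult_pos_neg)
      show "R2 > 0" using \<open>0 < s\<close> \<open>s \<le> R2\<close> by linarith
      show "slope R2 < 0" using slope2 \<open>sqrt Q > 0\<close> by linarith
    qed
    finally have "(a + \<gamma> * s\<^sup>2 / 2) / s < 0" using \<open>0 < s\<close> by (simp add: divide_neg_pos)
    then have "a / s + \<gamma> * s / 2 < 0"
      using \<open>0 < s\<close> by (simp add: field_simps power2_eq_square)
    then show "\<exists>y. (?V a has_real_derivative y) (at s) \<and> y < 0"
      using radial_profile_has_real_derivative[OF \<open>l > 0\<close> \<open>0 < s\<close>] by blast
  qed
  have range: "l \<le> norm x \<and> norm x \<le> R2" if "x \<in> closure (\<Omega> - ball 0 l)" for x
  proof -
    have "closure (\<Omega> - ball 0 l) \<subseteq> {x. l \<le> norm x} \<inter> {x. norm x \<le> R2}"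
      unfolding Om
      by (rule closure_minimal) (auto intro!: closed_Collect_le closed_Int continuous_intros)
    then show ?thesis using that by blast
  qed
  have "\<psi> x = ?V a (norm x)" if "x \<in> closure (\<Omega> - ball 0 l)" for x
  proof -
    have "l \<le> norm x" "norm x \<le> R2" using range[OF that] by auto
    then consider "norm x = l" | "norm x = R2" | "l < norm x" "norm x < R2"
      by fastforce
    then show ?thesis
    proof cases
      case 1
      then show ?thesis using one \<open>l > 0\<close> by simp
    next
      case 2
      then have "x \<in> frontier \<Omega>" using \<open>l < R2\<close> \<open>l > 0\<close> by (simp add: Om frontier_ball)
      then show ?thesis using zero 2 Vp \<open>norm p = R2\<close> by simp
    next
      case 3
      then have "x \<in> U" by (simp add: U_def Om)
      then have "x \<in> closure U" using closure_subset by blast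
      then show ?thesis
        using upper[of x] lower[of x] 3 \<open>R1 = R2\<close> a by force
    qed
  qed
  moreover have "strict_antimono_on (norm ` closure (\<Omega> - ball 0 l)) (?V a)"
    by (rule monotone_onI) (use range decr in auto)
  ultimately have "radially_decreasing_on (closure (\<Omega> - ball 0 l)) \<psi>"
    unfolding radially_decreasing_on_def by blast
  then show ?thesis using Om \<open>l < R2\<close> by blast
qed

theorem mainTheorem7:
  fixes lam \<gamma> :: real and \<Omega> :: "(real^2) set"
  assumes "lam > 0" and "\<gamma> \<ge> 0"
    and "open \<Omega>" and "connected \<Omega>" and "bounded \<Omega>" and "simply_connected \<Omega>"
    and "C2_boundary \<Omega>"
    and "cball 0 lam \<subseteq> \<Omega>"
    and "\<exists>Q>0. \<exists>\<psi>. positive_solution lam \<gamma> \<Omega> Q \<psi>"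
  shows "is_annulus (\<Omega> - cball 0 lam) \<and>
         (\<forall>Q>0. \<forall>\<psi>. positive_solution lam \<gamma> \<Omega> Q \<psi> \<longrightarrow>
            radially_decreasing_on (closure (\<Omega> - ball 0 lam)) \<psi>)"
proof -
  note radial = positive_solution_radial[OF assms(1-5,7,8)]
  obtain R where "lam < R" "\<Omega> = ball 0 R"
    using assms(9) radial by blast
  then have "is_annulus (\<Omega> - cball 0 lam)"
    unfolding is_annulus_def using assms(1)
    by (intro exI[of _ 0] exI[of _ lam] exI[of _ R]) auto
  then show ?thesis using radial by blast
qed

end
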